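(* Let $f_\theta:\mathbb{R}^m\to\mathbb{R}^n$ ($\theta\in\mathbb{R}^p$) and $g_\psi:\mathbb{R}^n\to\mathbb{R}^n$ ($\psi\in\mathbb{R}^q$) be smooth neural networks whose last layer is linear, and assume that they are not identically $0$, i.e. there exist $\theta_0,\psi_0,x_0,z_0$ such that $f_{\theta_0}(x_0)\neq 0$ and $g_{\psi_0}(z_0)\neq 0$. For $\lambda\ge 0$ let $$F(\theta,\psi,\xi,x,y)=\tfrac12\|g_\psi(f_\theta(x))-f_\xi(y)\|^2+\tfrac{\lambda}{2}\big(\|\theta\|^2+\|\psi\|^2\big).$$ Then the vector fields $$(\theta,\psi)\mapsto\mathbb{E}_{x,y}\big[\nabla_\theta F(\theta,\psi,\xi,x,y)|_{\xi=\theta}\big],\qquad (\theta,\psi)\mapsto\mathbb{E}_{x,y}\big[\nabla_\psi F(\theta,\psi,\xi,x,y)|_{\xi=\theta}\big]$$ are not, in general, the gradient fields (with respect to $\theta$ and to $\psi$, respectively) of any smooth scalar function of $(\theta,\psi)$.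
   Context: Here $(x,y)$ is a random pair in $\mathbb{R}^m\times\mathbb{R}^m$ whose law is the data distribution. The gradients $\nabla_\theta F$ and $\nabla_\psi F$ are taken with respect to the first and second arguments of $F$ with $\xi$ held fixed, and only afterwards is $\xi$ set equal to $\theta$ (stop gradient). Explicitly, with $u(\theta,\psi,x)=g_\psi(f_\theta(x))$, the two integrands are $J_\theta u(\theta,\psi,x)^T[u(\theta,\psi,x)-f_\theta(y)]+\lambda\theta$ and $J_\psi u(\theta,\psi,x)^T[u(\theta,\psi,x)-f_\theta(y)]+\lambda\psi$, where $J_\theta u$ and $J_\psi u$ are Jacobians. "Last layer is linear" means that $f_\theta(x)=A\,\phi(U,x)$ and $g_\psi(z)=B\,h(V,z)$, where $A$ is an $n\times k$ matrix and $B$ an $n\times d$ matrix for some positive integers $k,d$, $U$ and $V$ are the remaining parameters, $\theta$ collects the entries of $(A,U)$, $\psi$ collects the entries of $(B,V)$, and $\phi$, $h$ are smooth with values in $\mathbb{R}^k$ and $\mathbb{R}^d$. "In general": a property holds in general if, although it may fail for certain data satisfying specific equations, it holds for generic data. Here genericity is over all possible data distributions and means that, even if the property fails for some data distribution $\mathbb{D}_0$, there exist perturbed data distributions $\mathbb{D}_\epsilon$ getting arbitrarily close to $\mathbb{D}_0$ as $\epsilon\to0$ for which it holds. *)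

theory Defs
  imports "HOL-Probability.Probability"
begin

text \<open>
  The domain is finite-dimensional, so a differentiable map is \<open>C\<^sup>k\<^sup>+\<^sup>1\<close> iff all its directional derivatives are \<open>C\<^sup>k\<close>.
\<close>

fun Ck :: "nat \<Rightarrow> ('a::euclidean_space \<Rightarrow> 'b::euclidean_space) \<Rightarrow> bool" where
  "Ck 0 f \<longleftrightarrow> continuous_on UNIV f"
| "Ck (Suc k) f \<longleftrightarrow>
     (\<forall>x. f differentiable (at x)) \<and> (\<forall>v. Ck k (\<lambda>x. frechet_derivative f (at x) v))"

definition smooth :: "('a::euclidean_space \<Rightarrow> 'b::euclidean_space) \<Rightarrow> bool" where
  "smooth f \<longleftrightarrow> (\<forall>k. Ck k f)"

text \<open>The value is only meaningful where the function is differentiable.\<close>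

definition gradient :: "('a::euclidean_space \<Rightarrow> real) \<Rightarrow> 'a \<Rightarrow> 'a" where
  "gradient f x = (THE D. GDERIV f x :> D)"

text \<open>
  The parameter vector \<open>\<theta>\<close> collects the entries of a matrix \<open>A\<close> and the remaining parameters \<open>U\<close>:
  the injection \<open>\<iota>\<close> says at which coordinate of \<open>\<theta>\<close> each entry of \<open>A\<close> is stored, and \<open>U\<close> consists
  of the coordinates outside the range of \<open>\<iota>\<close>. There may be none of these, which is why \<open>U\<close> is not
  given a Euclidean type of its own (its dimension would be positive). A function of \<open>(U, x)\<close> is
  a function of \<open>(\<theta>, x)\<close> that ignores the coordinates in the range of \<open>\<iota>\<close>.
\<close>

definition linear_last_layer ::
  "('n::finite \<times> 'k::finite \<Rightarrow> 'p::finite) \<Rightarrow> (real^'p \<Rightarrow> real^'m::finite \<Rightarrow> real^'k) \<Rightarrow>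
   (real^'p \<Rightarrow> real^'m \<Rightarrow> real^'n) \<Rightarrow> bool" where
  "linear_last_layer \<iota> \<phi> f \<longleftrightarrow>
     inj \<iota> \<and>
     smooth (\<lambda>(\<theta>, x). \<phi> \<theta> x) \<and>
     (\<forall>\<theta> \<theta>' x. (\<forall>s. s \<notin> range \<iota> \<longrightarrow> \<theta> $ s = \<theta>' $ s) \<longrightarrow> \<phi> \<theta> x = \<phi> \<theta>' x) \<and>
     (\<forall>\<theta> x. f \<theta> x = (\<chi> i j. \<theta> $ \<iota> (i, j)) *v \<phi> \<theta> x)"

definition loss ::
  "(real^'p::finite \<Rightarrow> real^'m::finite \<Rightarrow> real^'n::finite) \<Rightarrow>
   (real^'q::finite \<Rightarrow> real^'n \<Rightarrow> real^'n) \<Rightarrow> real \<Rightarrow>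
   real^'p \<Rightarrow> real^'q \<Rightarrow> real^'p \<Rightarrow> real^'m \<Rightarrow> real^'m \<Rightarrow> real" where
  "loss f g lam \<theta> \<psi> \<xi> x y =
     1/2 * (norm (g \<psi> (f \<theta> x) - f \<xi> y))\<^sup>2 + lam/2 * ((norm \<theta>)\<^sup>2 + (norm \<psi>)\<^sup>2)"

definition grad_theta ::
  "(real^'p::finite \<Rightarrow> real^'m::finite \<Rightarrow> real^'n::finite) \<Rightarrow>
   (real^'q::finite \<Rightarrow> real^'n \<Rightarrow> real^'n) \<Rightarrow> real \<Rightarrow>
   real^'p \<Rightarrow> real^'q \<Rightarrow> real^'p \<Rightarrow> real^'m \<Rightarrow> real^'m \<Rightarrow> real^'p" where
  "grad_theta f g lam \<theta> \<psi> \<xi> x y = gradient (\<lambda>t. loss f g lam t \<psi> \<xi> x y) \<theta>"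

definition grad_psi ::
  "(real^'p::finite \<Rightarrow> real^'m::finite \<Rightarrow> real^'n::finite) \<Rightarrow>
   (real^'q::finite \<Rightarrow> real^'n \<Rightarrow> real^'n) \<Rightarrow> real \<Rightarrow>
   real^'p \<Rightarrow> real^'q \<Rightarrow> real^'p \<Rightarrow> real^'m \<Rightarrow> real^'m \<Rightarrow> real^'q" where
  "grad_psi f g lam \<theta> \<psi> \<xi> x y = gradient (\<lambda>s. loss f g lam \<theta> s \<xi> x y) \<psi>"

text \<open>Stop gradient: \<open>\<xi>\<close> is set to \<open>\<theta>\<close> only after the gradient has been taken.\<close>

definition field_theta ::
  "(real^'p::finite \<Rightarrow> real^'m::finite \<Rightarrow> real^'n::finite) \<Rightarrow>
   (real^'q::finite \<Rightarrow> real^'n \<Rightarrow> real^'n) \<Rightarrow> real \<Rightarrow>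
   ((real^'m) \<times> (real^'m)) measure \<Rightarrow> real^'p \<Rightarrow> real^'q \<Rightarrow> real^'p" where
  "field_theta f g lam D \<theta> \<psi> = (\<integral>(x, y). grad_theta f g lam \<theta> \<psi> \<theta> x y \<partial>D)"

definition field_psi ::
  "(real^'p::finite \<Rightarrow> real^'m::finite \<Rightarrow> real^'n::finite) \<Rightarrow>
   (real^'q::finite \<Rightarrow> real^'n \<Rightarrow> real^'n) \<Rightarrow> real \<Rightarrow>
   ((real^'m) \<times> (real^'m)) measure \<Rightarrow> real^'p \<Rightarrow> real^'q \<Rightarrow> real^'q" where
  "field_psi f g lam D \<theta> \<psi> = (\<integral>(x, y). grad_psi f g lam \<theta> \<psi> \<theta> x y \<partial>D)"

text \<open>
  All laws of a pair \<open>(x, y)\<close> for which the two expectations exist at every \<open>(\<theta>, \<psi>)\<close>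
  (the Bochner integral of a non-integrable function would silently be 0).
\<close>

definition data_distribution ::
  "(real^'p::finite \<Rightarrow> real^'m::finite \<Rightarrow> real^'n::finite) \<Rightarrow>
   (real^'q::finite \<Rightarrow> real^'n \<Rightarrow> real^'n) \<Rightarrow> real \<Rightarrow>
   ((real^'m) \<times> (real^'m)) measure \<Rightarrow> bool" where
  "data_distribution f g lam D \<longleftrightarrow>
     prob_space D \<and> sets D = sets borel \<and>
     (\<forall>\<theta> \<psi>. integrable D (\<lambda>(x, y). grad_theta f g lam \<theta> \<psi> \<theta> x y) \<and>
             integrable D (\<lambda>(x, y). grad_psi f g lam \<theta> \<psi> \<theta> x y))"

definition are_gradient_fields ::
  "(real^'p::finite \<Rightarrow> real^'q::finite \<Rightarrow> real^'p) \<Rightarrow> (real^'p \<Rightarrow> real^'q \<Rightarrow> real^'q) \<Rightarrow> bool" where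
  "are_gradient_fields G H \<longleftrightarrow>
     (\<exists>L :: (real^'p) \<times> (real^'q) \<Rightarrow> real. smooth L \<and>
        (\<forall>\<theta> \<psi>. GDERIV (\<lambda>t. L (t, \<psi>)) \<theta> :> (G \<theta> \<psi>) \<and>
                GDERIV (\<lambda>s. L (\<theta>, s)) \<psi> :> (H \<theta> \<psi>)))"

definition tv_dist :: "'a measure \<Rightarrow> 'a measure \<Rightarrow> real" where
  "tv_dist M N = (SUP A\<in>sets M. \<bar>measure M A - measure N A\<bar>)"

text \<open>
  Genericity within a class \<open>adm\<close> of distributions: every member of the class is approached, as
  \<open>\<epsilon> \<rightarrow> 0\<close>, by members of the class that have property \<open>P\<close>. Closeness is measured in total variation,
  which implies closeness in the weak topology.
\<close>

definition holds_in_general ::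
  "('a measure \<Rightarrow> bool) \<Rightarrow> ('a measure \<Rightarrow> bool) \<Rightarrow> bool" where
  "holds_in_general adm P \<longleftrightarrow>
     (\<forall>D0. adm D0 \<longrightarrow>
        (\<exists>D :: real \<Rightarrow> 'a measure.
           (\<forall>\<epsilon>>0. adm (D \<epsilon>) \<and> P (D \<epsilon>)) \<and>
           ((\<lambda>\<epsilon>. tv_dist (D \<epsilon>) D0) \<longlongrightarrow> 0) (at_right 0)))"

end

theory Submission
  imports Defs
begin

text \<open>
  The fields depend linearly on the data distribution. So if the fields of \<open>D\<^sub>0\<close> are gradients,
  then mixing in a small multiple of a point mass destroys this property, provided that the fields
  of the point mass are not gradients. For the point mass at \<open>(x, y)\<close>, subtract the loss at
  \<open>\<xi> = \<theta>\<close> from a hypothetical potential. The result has zero gradient in \<open>\<psi>\<close>, so its \<open>\<theta>\<close>-gradient,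
  which is minus the \<open>\<xi>\<close>-gradient of the loss, does not depend on \<open>\<psi>\<close>.
  Comparison with \<open>\<psi> = 0\<close>, where \<open>g\<close> vanishes, shows that \<open>g\<^sub>\<psi>(f\<^sub>\<theta>(x))\<close> is orthogonal to every
  direction in which \<open>f\<^sub>\<theta>(y)\<close> can move. Since the last layer of \<open>f\<close> is linear, for suitable \<open>\<theta>\<close> these
  are all directions.
\<close>

section \<open>Gradients and differentiability\<close>

lemma GDERIV_unique:
  assumes "GDERIV f x :> D" and "GDERIV f x :> E"
  shows "D = E"
proof -
  have "(\<lambda>h. h \<bullet> D) = (\<lambda>h. h \<bullet> E)"
    using assms unfolding gderiv_def by (rule has_derivative_unique)
  then show ?thesis
    by (metis vector_eq_ldot)
qed

lemma gradient_eqI: "GDERIV f x :> D \<Longrightarrow> gradient f x = D"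
  unfolding gradient_def using GDERIV_unique by blast

text \<open>Riesz representation in finite dimension: a linear functional \<open>f'\<close> is the
  inner product with the vector \<open>adjoint f' 1\<close>.\<close>

lemma GDERIV_gradient:
  fixes f :: "'a::euclidean_space \<Rightarrow> real"
  assumes "f differentiable (at x)"
  shows "GDERIV f x :> gradient f x"
proof -
  obtain f' where f': "(f has_derivative f') (at x)"
    using assms unfolding differentiable_def by blast
  then have "linear f'"
    using has_derivative_linear by blast
  then have "f' h = h \<bullet> adjoint f' 1" for h
    using adjoint_works[of f' h 1] by simp
  then have "f' = (\<lambda>h. h \<bullet> adjoint f' 1)"
    by blast
  then have "GDERIV f x :> adjoint f' 1"
    using f' unfolding gderiv_def by simp
  then show ?thesis
    using gradient_eqI by metis
qed

lemma GDERIV_zero_constant: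
  fixes f :: "'a::real_inner \<Rightarrow> real"
  assumes "\<And>x. GDERIV f x :> 0"
  shows "f x = f y"
proof -
  have "\<exists>c. \<forall>x\<in>UNIV. f x = c"
    using assms by (intro has_derivative_zero_constant) (auto simp: gderiv_def)
  then show ?thesis
    by auto
qed

lemma GDERIV_along_line:
  assumes "GDERIV f x :> D"
  shows "DERIV (\<lambda>t. f (x + t *\<^sub>R v)) 0 :> v \<bullet> D"
proof -
  have "((\<lambda>t. x + t *\<^sub>R v) has_derivative (\<lambda>t. t *\<^sub>R v)) (at 0)"
    by (auto intro!: derivative_eq_intros)
  then have "((\<lambda>t. f (x + t *\<^sub>R v)) has_derivative (\<lambda>t. (t *\<^sub>R v) \<bullet> D)) (at 0)"
    using assms has_derivative_compose[of "\<lambda>t. x + t *\<^sub>R v" "\<lambda>t. t *\<^sub>R v" 0 UNIV f "\<lambda>h. h \<bullet> D"]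
    by (simp add: gderiv_def)
  then show ?thesis
    by (simp add: has_field_derivative_def mult_commute_abs)
qed

lemma smooth_differentiable: "smooth f \<Longrightarrow> f differentiable (at x)"
  unfolding smooth_def using Ck.simps(2)[of 0 f] by blast

lemma differentiable_compose_at:
  "f differentiable (at (g x)) \<Longrightarrow> g differentiable (at x) \<Longrightarrow> (\<lambda>x. f (g x)) differentiable (at x)"
  using differentiable_chain_at[of g x f] by (simp add: o_def)

lemma differentiable_vec_nth:
  fixes F :: "'a::real_normed_vector \<Rightarrow> real^'n::finite"
  assumes "F differentiable (at p)"
  shows "(\<lambda>p. F p $ s) differentiable (at p)"
  by (rule differentiable_compose_at[OF bounded_linear_imp_differentiable[OF bounded_linear_vec_nth]
        assms])

section \<open>Networks with linear last layer\<close>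

lemma linear_last_layer_differentiable:
  fixes f :: "real^'p::finite \<Rightarrow> real^'m::finite \<Rightarrow> real^'n::finite"
    and \<iota> :: "'n \<times> 'k::finite \<Rightarrow> 'p"
  assumes "linear_last_layer \<iota> \<phi> f"
  shows "(\<lambda>(\<theta>, x). f \<theta> x) differentiable (at p)"
proof -
  have \<phi>: "(\<lambda>p. \<phi> (fst p) (snd p)) differentiable (at p)"
    using assms smooth_differentiable unfolding linear_last_layer_def case_prod_beta by blast
  \<comment> \<open>Expanding the matrix-vector product in the standard basis reduces
    differentiability to that of sums and products of coordinates.\<close>
  have "(\<lambda>p. f (fst p) (snd p)) =
    (\<lambda>p. \<Sum>i\<in>UNIV. (\<Sum>j\<in>UNIV. fst p $ \<iota> (i, j) * \<phi> (fst p) (snd p) $ j) *\<^sub>R axis i 1)"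
    using assms unfolding linear_last_layer_def
    by (auto simp: fun_eq_iff vec_eq_iff matrix_vector_mult_def axis_def
        if_distrib cong: if_cong)
  moreover have "fst differentiable (at p)"
    by (rule bounded_linear_imp_differentiable[OF bounded_linear_fst])
  ultimately show ?thesis
    unfolding case_prod_beta
    by (simp add: differentiable_sum differentiable_scaleR differentiable_mult
        differentiable_vec_nth \<phi>)
qed

lemma
  fixes f :: "real^'p::finite \<Rightarrow> real^'m::finite \<Rightarrow> real^'n::finite"
    and \<iota> :: "'n \<times> 'k::finite \<Rightarrow> 'p"
  assumes "linear_last_layer \<iota> \<phi> f"
  shows linear_last_layer_differentiable_parameter: "(\<lambda>t. f t x) differentiable (at \<theta>)"
    and linear_last_layer_differentiable_input: "(\<lambda>z. f \<theta> z) differentiable (at x)"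
proof -
  note diff = linear_last_layer_differentiable[OF assms]
  show "(\<lambda>t. f t x) differentiable (at \<theta>)"
    using differentiable_compose_at[where g = "\<lambda>t. (t, x)", OF diff] by (simp add: differentiable_Pair)
  show "(\<lambda>z. f \<theta> z) differentiable (at x)"
    using differentiable_compose_at[where g = "\<lambda>z. (\<theta>, z)", OF diff] by (simp add: differentiable_Pair)
qed

lemma linear_last_layer_zero: "linear_last_layer \<kappa> h g \<Longrightarrow> g 0 z = 0"
  unfolding linear_last_layer_def by (simp add: vec_eq_iff matrix_vector_mult_def)

text \<open>Only entries of the last matrix are changed, so the features stay fixed and the output
  is affine in the step \<open>t\<close>. This serves both to move the target \<open>f\<close> at
  \<open>y\<close> in a chosen direction and, with \<open>t = 1\<close>, to make \<open>f\<close>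
  attain a chosen value.\<close>

lemma linear_last_layer_move_output:
  fixes f :: "real^'p::finite \<Rightarrow> real^'m::finite \<Rightarrow> real^'n::finite"
    and \<iota> :: "'n \<times> 'k::finite \<Rightarrow> 'p" and z :: "real^'n"
  assumes f: "linear_last_layer \<iota> \<phi> f" and nz: "\<phi> \<theta> y \<noteq> 0"
  obtains v where "\<And>t. f (\<theta> + t *\<^sub>R v) y = f \<theta> y + t *\<^sub>R z" and "\<phi> (\<theta> + v) y = \<phi> \<theta> y"
proof -
  have inj: "inj \<iota>"
    and dep: "(\<forall>s. s \<notin> range \<iota> \<longrightarrow> \<theta> $ s = \<theta>' $ s) \<Longrightarrow> \<phi> \<theta> x = \<phi> \<theta>' x"
    and fdef: "f \<theta> x = (\<chi> i j. \<theta> $ \<iota> (i, j)) *v \<phi> \<theta> x" for \<theta> \<theta>' x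
    using f unfolding linear_last_layer_def by blast+
  obtain j0 where j0: "\<phi> \<theta> y $ j0 \<noteq> 0"
    using nz by (auto simp: vec_eq_iff)
  \<comment> \<open>The matrix \<open>c\<close> has one nonzero column, at an index
    \<open>j0\<close> where the feature vector does not vanish, scaled so that \<open>c\<close>
    sends this vector to \<open>z\<close>.\<close>
  define c where "c = (\<lambda>(i, j). if j = j0 then z $ i / \<phi> \<theta> y $ j0 else 0)"
  define v where "v = (\<chi> s. if s \<in> range \<iota> then c (inv \<iota> s) else 0)"
  have v: "v $ \<iota> ij = c ij" for ij
    using inj by (simp add: v_def)
  have \<phi>: "\<phi> (\<theta> + t *\<^sub>R v) y = \<phi> \<theta> y" for t
    by (rule dep) (simp add: v_def)
  have "(\<Sum>j\<in>UNIV. c (i, j) * \<phi> \<theta> y $ j) = z $ i" for i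
    using j0 by (simp add: c_def if_distrib[of "\<lambda>a. a * _"] cong: if_cong)
  then have "f (\<theta> + t *\<^sub>R v) y = f \<theta> y + t *\<^sub>R z" for t
    by (simp add: fdef \<phi> v vec_eq_iff matrix_vector_mult_def distrib_right sum.distrib
        mult.assoc flip: sum_distrib_left)
  then show ?thesis
    using \<phi>[of 1] by (intro that) simp_all
qed

section \<open>The fields of a point mass\<close>

text \<open>Since \<open>gradient\<close> is a definite description, \<open>grad_theta\<close> and
  \<open>grad_psi\<close> become usable only once the loss is known to be differentiable in the
  respective argument.\<close>

lemma
  fixes f :: "real^'p::finite \<Rightarrow> real^'m::finite \<Rightarrow> real^'n::finite"
    and g :: "real^'q::finite \<Rightarrow> real^'n \<Rightarrow> real^'n"
    and \<iota> :: "'n \<times> 'k::finite \<Rightarrow> 'p" and \<kappa> :: "'n \<times> 'd::finite \<Rightarrow> 'q"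
  assumes f: "linear_last_layer \<iota> \<phi> f" and g: "linear_last_layer \<kappa> h g"
  shows GDERIV_loss_theta: "GDERIV (\<lambda>t. loss f g lam t \<psi> \<xi> x y) \<theta> :> grad_theta f g lam \<theta> \<psi> \<xi> x y"
    and GDERIV_loss_psi: "GDERIV (\<lambda>s. loss f g lam \<theta> s \<xi> x y) \<psi> :> grad_psi f g lam \<theta> \<psi> \<xi> x y"
proof -
  have 1: "(\<lambda>t. g \<psi> (f t x)) differentiable (at \<theta>)"
    by (rule differentiable_compose_at[OF linear_last_layer_differentiable_input[OF g]
          linear_last_layer_differentiable_parameter[OF f]])
  have 2: "(\<lambda>s. g s (f \<theta> x)) differentiable (at \<psi>)"
    by (rule linear_last_layer_differentiable_parameter[OF g])
  show "GDERIV (\<lambda>t. loss f g lam t \<psi> \<xi> x y) \<theta> :> grad_theta f g lam \<theta> \<psi> \<xi> x y"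
    unfolding grad_theta_def loss_def power2_norm_eq_inner
    by (intro GDERIV_gradient) (auto intro!: derivative_intros differentiable_inner 1)
  show "GDERIV (\<lambda>s. loss f g lam \<theta> s \<xi> x y) \<psi> :> grad_psi f g lam \<theta> \<psi> \<xi> x y"
    unfolding grad_psi_def loss_def power2_norm_eq_inner
    by (intro GDERIV_gradient) (auto intro!: derivative_intros differentiable_inner 2)
qed

lemma no_potential_point_mass:
  fixes f :: "real^'p::finite \<Rightarrow> real^'m::finite \<Rightarrow> real^'n::finite"
    and g :: "real^'q::finite \<Rightarrow> real^'n \<Rightarrow> real^'n"
    and \<iota> :: "'n \<times> 'k::finite \<Rightarrow> 'p" and \<kappa> :: "'n \<times> 'd::finite \<Rightarrow> 'q"
    and L :: "(real^'p) \<times> (real^'q) \<Rightarrow> real"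
  assumes f: "linear_last_layer \<iota> \<phi> f" and g: "linear_last_layer \<kappa> h g"
    and nz_y: "\<phi> \<theta> y \<noteq> 0" and nz_x: "g \<psi> (f \<theta> x) \<noteq> 0"
    and L_theta: "\<And>\<theta> \<psi>. GDERIV (\<lambda>t. L (t, \<psi>)) \<theta> :> grad_theta f g lam \<theta> \<psi> \<theta> x y"
    and L_psi: "\<And>\<theta> \<psi>. GDERIV (\<lambda>s. L (\<theta>, s)) \<psi> :> grad_psi f g lam \<theta> \<psi> \<theta> x y"
  shows False
proof -
  \<comment> \<open>The target will be moved in the direction of the prediction itself, so that the
    final orthogonality relation reads \<open>z \<bullet> z = 0\<close>.\<close>
  define z where "z = g \<psi> (f \<theta> x)"
  obtain v where v: "\<And>t. f (\<theta> + t *\<^sub>R v) y = f \<theta> y + t *\<^sub>R z"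
    using linear_last_layer_move_output[OF f nz_y] by metis
  define \<gamma> where "\<gamma> = (\<lambda>t. \<theta> + t *\<^sub>R v)"
  \<comment> \<open>For each fixed \<open>t\<close> the loss has \<open>\<xi>\<close> frozen at
    \<open>\<gamma> t\<close>, so its gradient in \<open>s\<close> is exactly the field at
    \<open>\<gamma> t\<close> and cancels that of \<open>L\<close>.\<close>
  define M where "M = (\<lambda>t s. L (\<gamma> t, s) - loss f g lam (\<gamma> t) s (\<gamma> t) x y)"
  have "GDERIV (M t) s :> 0" for t s
    using GDERIV_diff[OF L_psi GDERIV_loss_psi[OF f g, of lam "\<gamma> t" "\<gamma> t" x y], of "\<gamma> t" s]
    unfolding M_def by simp
  then have M_const: "M t s = M t s'" for t s s'
    by (rule GDERIV_zero_constant)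
  \<comment> \<open>\<open>t * k s t\<close> is the increment of the loss when \<open>\<xi>\<close> alone moves from \<open>\<theta>\<close> to \<open>\<gamma> t\<close>.\<close>
  define k where "k s t = - (z \<bullet> (g s (f (\<gamma> t) x) - f \<theta> y)) + t / 2 * (z \<bullet> z)" for s t
  \<comment> \<open>In the bracket \<open>\<xi>\<close> is frozen at \<open>\<theta>\<close>, so its
    derivative at \<open>t = 0\<close> vanishes by \<open>L_theta\<close>; all first-order change of
    \<open>M\<close> sits in \<open>t * k s t\<close>.\<close>
  have M_eq: "M t s = (L (\<gamma> t, s) - loss f g lam (\<gamma> t) s \<theta> x y) - t * k s t" for s t
    unfolding M_def k_def loss_def power2_norm_eq_inner \<gamma>_def v
    by (simp add: algebra_simps inner_commute)
  have "DERIV (\<lambda>t. M t s) 0 :> - k s 0" for s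
  proof -
    have "(\<lambda>t. g s (f t x)) differentiable (at (\<gamma> 0))"
      by (rule differentiable_compose_at[OF linear_last_layer_differentiable_input[OF g]
            linear_last_layer_differentiable_parameter[OF f]])
    then have "isCont (\<lambda>t. g s (f t x)) (\<gamma> 0)"
      by (rule differentiable_imp_continuous_within)
    moreover have "isCont \<gamma> 0"
      unfolding \<gamma>_def by (intro continuous_intros)
    ultimately have "isCont (\<lambda>t. g s (f (\<gamma> t) x)) 0"
      by (rule isCont_o2[rotated])
    then have "isCont (k s) 0"
      unfolding k_def by (intro continuous_intros) auto
    \<comment> \<open>Caratheodory's criterion: continuity of \<open>k s\<close> at 0 suffices for
      this derivative.\<close>
    then have "DERIV (\<lambda>t. t * k s t) 0 :> k s 0"
      unfolding CARAT_DERIV by (intro exI[of _ "k s"]) auto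
    moreover have "DERIV (\<lambda>t. L (\<gamma> t, s) - loss f g lam (\<gamma> t) s \<theta> x y) 0 :> 0"
      using GDERIV_along_line[OF GDERIV_diff[OF
            L_theta[of s \<theta>] GDERIV_loss_theta[OF f g, of lam s \<theta> x y]], of v]
      unfolding \<gamma>_def by simp
    ultimately have "DERIV (\<lambda>t. (L (\<gamma> t, s) - loss f g lam (\<gamma> t) s \<theta> x y) - t * k s t) 0 :> 0 - k s 0"
      by (intro DERIV_diff)
    then show ?thesis
      unfolding M_eq by simp
  qed
  moreover have "(\<lambda>t. M t \<psi>) = (\<lambda>t. M t 0)"
    using M_const by blast
  \<comment> \<open>The two sides are the inner products of \<open>z\<close> with
    \<open>z - f \<theta> y\<close> and with \<open>- f \<theta> y\<close>, because \<open>g\<close>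
    vanishes at parameter 0; the target term cancels.\<close>
  ultimately have "- k \<psi> 0 = - k 0 0"
    by (intro DERIV_unique[of "\<lambda>t. M t 0" _ 0]) metis+
  then have "z \<bullet> z = 0"
    by (simp add: k_def \<gamma>_def z_def linear_last_layer_zero[OF g] inner_diff_right)
  then show False
    using nz_x by (simp add: z_def)
qed

section \<open>Mixing in a point mass\<close>

text \<open>The mixture of the point mass at \<open>p\<close> with weight \<open>w\<close> and
  \<open>D\<close> with weight \<open>1 - w\<close>, for \<open>w\<close> in [0,1]. It is realised
  as the law of a sample chosen by a coin flip, so that integrals reduce to Fubini's
  theorem.\<close>

definition add_point_mass :: "real \<Rightarrow> 'a \<Rightarrow> 'a measure \<Rightarrow> 'a measure" where
  "add_point_mass w p D =
     distr (measure_pmf (bernoulli_pmf w) \<Otimes>\<^sub>M D) D (\<lambda>(b, q). if b then p else q)"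

lemma sets_add_point_mass [simp, measurable_cong]: "sets (add_point_mass w p D) = sets D"
  by (simp add: add_point_mass_def)

lemma measurable_add_point_mass_selector:
  assumes "p \<in> space D"
  shows "(\<lambda>(b, q). if b then p else q) \<in> measurable (measure_pmf W \<Otimes>\<^sub>M D) D"
proof -
  have "(\<lambda>z. fst z) \<in> measurable (measure_pmf W \<Otimes>\<^sub>M D) (count_space UNIV)"
    by (rule measurable_compose[OF measurable_fst]) simp
  then show ?thesis
    using assms by (auto simp: case_prod_beta intro!: measurable_If)
qed

context
  fixes w :: real and p :: 'a and D :: "'a measure"
  assumes w: "0 \<le> w" "w \<le> 1" and p: "p \<in> space D" and D: "prob_space D"
begin

lemma prob_space_add_point_mass: "prob_space (add_point_mass w p D)"
proof -
  interpret D: prob_space D by (rule D)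
  interpret P: pair_prob_space "measure_pmf (bernoulli_pmf w)" D ..
  show ?thesis
    unfolding add_point_mass_def
    by (rule P.prob_space_distr[OF measurable_add_point_mass_selector[OF p]])
qed

text \<open>Integrate over \<open>q\<close> first; the remaining integral over the coin is a sum of
  two terms.\<close>

lemma
  fixes F :: "'a \<Rightarrow> 'b::{banach, second_countable_topology}"
  assumes F: "integrable D F"
  shows integrable_add_point_mass: "integrable (add_point_mass w p D) F"
    and integral_add_point_mass:
      "integral\<^sup>L (add_point_mass w p D) F = w *\<^sub>R F p + (1 - w) *\<^sub>R integral\<^sup>L D F"
proof -
  interpret D: prob_space D by (rule D)
  interpret P: pair_prob_space "measure_pmf (bernoulli_pmf w)" D ..
  note sel = measurable_add_point_mass_selector[OF p, of "bernoulli_pmf w"]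
  have meas: "(\<lambda>z. F (case z of (b, q) \<Rightarrow> if b then p else q)) \<in>
      borel_measurable (measure_pmf (bernoulli_pmf w) \<Otimes>\<^sub>M D)"
    using measurable_compose[OF sel borel_measurable_integrable[OF F]] .
  have int: "integrable (measure_pmf (bernoulli_pmf w) \<Otimes>\<^sub>M D)
      (\<lambda>z. F (case z of (b, q) \<Rightarrow> if b then p else q))"
  proof (rule P.Fubini_integrable[OF meas])
    show "AE b in measure_pmf (bernoulli_pmf w).
        integrable D (\<lambda>q. F (case (b, q) of (b, q) \<Rightarrow> if b then p else q))"
    proof (rule AE_I2)
      show "integrable D (\<lambda>q. F (case (b, q) of (b, q) \<Rightarrow> if b then p else q))" for b
        using F by (cases b) simp_all
    qed
  qed (auto intro!: integrable_measure_pmf_finite)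
  then show "integrable (add_point_mass w p D) F"
    unfolding add_point_mass_def
    using integrable_distr_eq[OF sel borel_measurable_integrable[OF F]] by simp
  have "integral\<^sup>L (add_point_mass w p D) F =
      (\<integral>b. (\<integral>q. F (if b then p else q) \<partial>D) \<partial>measure_pmf (bernoulli_pmf w))"
    unfolding add_point_mass_def integral_distr[OF sel borel_measurable_integrable[OF F]]
    using P.integral_fst'[OF int] by simp
  also have "\<dots> = w *\<^sub>R F p + (1 - w) *\<^sub>R integral\<^sup>L D F"
    using w by (subst integral_measure_pmf[of UNIV]) (auto simp: UNIV_bool D.prob_space)
  finally show "integral\<^sup>L (add_point_mass w p D) F = w *\<^sub>R F p + (1 - w) *\<^sub>R integral\<^sup>L D F" .
qed

lemma measure_add_point_mass:
  assumes A: "A \<in> sets D"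
  shows "measure (add_point_mass w p D) A = w * indicator A p + (1 - w) * measure D A"
proof -
  interpret D: prob_space D by (rule D)
  have "integrable D (indicator A :: 'a \<Rightarrow> real)"
    using A by (simp add: D.emeasure_eq_measure)
  from integral_add_point_mass[OF this] show ?thesis
    using A by simp
qed

lemma
  shows tv_dist_add_point_mass_nonneg: "0 \<le> tv_dist (add_point_mass w p D) D"
    and tv_dist_add_point_mass_le: "tv_dist (add_point_mass w p D) D \<le> w"
proof -
  interpret D: prob_space D by (rule D)
  have le: "\<bar>measure (add_point_mass w p D) A - measure D A\<bar> \<le> w" if "A \<in> sets D" for A
  proof -
    have "measure (add_point_mass w p D) A - measure D A = w * (indicator A p - measure D A)"
      using measure_add_point_mass[OF that] by (simp add: algebra_simps)
    moreover have "\<bar>indicator A p - measure D A\<bar> \<le> 1"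
      using D.prob_le_1[of A] measure_nonneg[of D A]
      by (cases "p \<in> A") (simp_all del: D.prob_le_1 measure_nonneg)
    ultimately show ?thesis
      using w by (simp add: abs_mult mult_left_le)
  qed
  then show "tv_dist (add_point_mass w p D) D \<le> w"
    unfolding tv_dist_def by (intro cSUP_least) (auto simp: sets.sets_into_space)
  \<comment> \<open>A real supremum dominates its members only for a family bounded above, hence the
    bound \<open>w\<close>; the empty set contributes the value 0.\<close>
  have "\<bar>measure (add_point_mass w p D) {} - measure D {}\<bar> \<le> tv_dist (add_point_mass w p D) D"
    unfolding tv_dist_def by (intro cSUP_upper bdd_aboveI2[where M = w]) (auto intro: le)
  then show "0 \<le> tv_dist (add_point_mass w p D) D"
    by simp
qed

end

lemma
  assumes w: "0 \<le> w" "w \<le> 1" and D: "data_distribution f g lam D"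
  shows data_distribution_add_point_mass:
      "data_distribution f g lam (add_point_mass w (x, y) D)"
    and field_theta_add_point_mass:
      "field_theta f g lam (add_point_mass w (x, y) D) \<theta> \<psi> =
         w *\<^sub>R grad_theta f g lam \<theta> \<psi> \<theta> x y + (1 - w) *\<^sub>R field_theta f g lam D \<theta> \<psi>"
    and field_psi_add_point_mass:
      "field_psi f g lam (add_point_mass w (x, y) D) \<theta> \<psi> =
         w *\<^sub>R grad_psi f g lam \<theta> \<psi> \<theta> x y + (1 - w) *\<^sub>R field_psi f g lam D \<theta> \<psi>"
proof -
  have prob: "prob_space D" and sets: "sets D = sets borel"
    using D unfolding data_distribution_def by auto
  have p: "(x, y) \<in> space D"
    using sets_eq_imp_space_eq[OF sets] by simp
  note int = D[unfolded data_distribution_def]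
  show "data_distribution f g lam (add_point_mass w (x, y) D)"
    using int prob_space_add_point_mass[OF w p prob]
    by (auto simp: data_distribution_def intro!: integrable_add_point_mass[OF w p prob])
  show "field_theta f g lam (add_point_mass w (x, y) D) \<theta> \<psi> =
      w *\<^sub>R grad_theta f g lam \<theta> \<psi> \<theta> x y + (1 - w) *\<^sub>R field_theta f g lam D \<theta> \<psi>"
    unfolding field_theta_def using int by (subst integral_add_point_mass[OF w p prob]) auto
  show "field_psi f g lam (add_point_mass w (x, y) D) \<theta> \<psi> =
      w *\<^sub>R grad_psi f g lam \<theta> \<psi> \<theta> x y + (1 - w) *\<^sub>R field_psi f g lam D \<theta> \<psi>"
    unfolding field_psi_def using int by (subst integral_add_point_mass[OF w p prob]) auto
qed

text \<open>Solves the mixture equation for the point mass: potentials \<open>K\<close> of the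
  mixture and \<open>L\<close> of \<open>D\<close> yield one for the point mass alone.\<close>

lemma GDERIV_unmix:
  assumes "w \<noteq> 0" and "GDERIV K x :> w *\<^sub>R a + (1 - w) *\<^sub>R b" and "GDERIV L x :> b"
  shows "GDERIV (\<lambda>x. (K x - (1 - w) * L x) / w) x :> a"
proof -
  have "((\<lambda>x. (K x - (1 - w) * L x) / w) has_derivative
      (\<lambda>h. (h \<bullet> (w *\<^sub>R a + (1 - w) *\<^sub>R b) - (1 - w) * (h \<bullet> b)) / w)) (at x)"
    using assms unfolding gderiv_def by (auto intro!: derivative_eq_intros)
  then show ?thesis
    using assms(1) by (simp add: gderiv_def inner_add_right)
qed

theorem proposition3p2:
  fixes f :: "real^'p::finite \<Rightarrow> real^'m::finite \<Rightarrow> real^'n::finite"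
    and g :: "real^'q::finite \<Rightarrow> real^'n \<Rightarrow> real^'n"
    and \<iota> :: "'n::finite \<times> 'k::finite \<Rightarrow> 'p" and \<phi> :: "real^'p \<Rightarrow> real^'m \<Rightarrow> real^'k"
    and \<kappa> :: "'n::finite \<times> 'd::finite \<Rightarrow> 'q" and h :: "real^'q \<Rightarrow> real^'n \<Rightarrow> real^'d"
    and lam :: real
  assumes f_last: "linear_last_layer \<iota> \<phi> f"
    and g_last: "linear_last_layer \<kappa> h g"
    and f_nonzero: "\<exists>\<theta>\<^sub>0 x\<^sub>0. f \<theta>\<^sub>0 x\<^sub>0 \<noteq> 0"
    and g_nonzero: "\<exists>\<psi>\<^sub>0 z\<^sub>0. g \<psi>\<^sub>0 z\<^sub>0 \<noteq> 0"
    and lam_nonneg: "lam \<ge> 0"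
  shows "holds_in_general (data_distribution f g lam)
           (\<lambda>D. \<not> are_gradient_fields (field_theta f g lam D) (field_psi f g lam D))"
proof -
  let ?P = "\<lambda>D. are_gradient_fields (field_theta f g lam D) (field_psi f g lam D)"
  obtain \<theta>\<^sub>0 x \<psi> z where "f \<theta>\<^sub>0 x \<noteq> 0" and nz: "g \<psi> z \<noteq> 0"
    using f_nonzero g_nonzero by blast
  then have \<phi>: "\<phi> \<theta>\<^sub>0 x \<noteq> 0"
    using f_last unfolding linear_last_layer_def by auto
  \<comment> \<open>One point \<open>x\<close> can serve as both input and target: the shift
    \<open>v\<close> makes the output at \<open>x\<close> equal to \<open>z\<close>, where
    \<open>g \<psi>\<close> is nonzero, while keeping the features at \<open>x\<close>
    nonzero.\<close>
  obtain v where "f (\<theta>\<^sub>0 + 1 *\<^sub>R v) x = f \<theta>\<^sub>0 x + 1 *\<^sub>R (z - f \<theta>\<^sub>0 x)"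
    and "\<phi> (\<theta>\<^sub>0 + v) x = \<phi> \<theta>\<^sub>0 x"
    using linear_last_layer_move_output[OF f_last \<phi>] by metis
  with \<phi> have \<theta>: "f (\<theta>\<^sub>0 + v) x = z" "\<phi> (\<theta>\<^sub>0 + v) x \<noteq> 0"
    by auto
  have mix: "\<not> ?P (add_point_mass w (x, x) D)"
    if w: "0 < w" "w \<le> 1" and D: "data_distribution f g lam D" and P: "?P D" for w D
  proof
    assume "?P (add_point_mass w (x, x) D)"
    then obtain K where
      "\<And>\<theta> \<psi>. GDERIV (\<lambda>t. K (t, \<psi>)) \<theta> :> field_theta f g lam (add_point_mass w (x, x) D) \<theta> \<psi>"
      "\<And>\<theta> \<psi>. GDERIV (\<lambda>s. K (\<theta>, s)) \<psi> :> field_psi f g lam (add_point_mass w (x, x) D) \<theta> \<psi>"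
      unfolding are_gradient_fields_def by blast
    note K = this[unfolded field_theta_add_point_mass[OF less_imp_le[OF w(1)] w(2) D]
        field_psi_add_point_mass[OF less_imp_le[OF w(1)] w(2) D]]
    obtain L where L: "\<And>\<theta> \<psi>. GDERIV (\<lambda>t. L (t, \<psi>)) \<theta> :> field_theta f g lam D \<theta> \<psi>"
      "\<And>\<theta> \<psi>. GDERIV (\<lambda>s. L (\<theta>, s)) \<psi> :> field_psi f g lam D \<theta> \<psi>"
      using P unfolding are_gradient_fields_def by blast
    show False
    proof (rule no_potential_point_mass[OF f_last g_last \<theta>(2)])
      show "g \<psi> (f (\<theta>\<^sub>0 + v) x) \<noteq> 0"
        using nz \<theta>(1) by simp
    qed (rule GDERIV_unmix[OF less_imp_neq[OF w(1), symmetric] K(1) L(1)]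
        GDERIV_unmix[OF less_imp_neq[OF w(1), symmetric] K(2) L(2)])+
  qed
  show ?thesis
    unfolding holds_in_general_def
  proof (intro allI impI)
    fix D\<^sub>0
    assume D\<^sub>0: "data_distribution f g lam D\<^sub>0"
    let ?adm = "data_distribution f g lam"
    show "\<exists>D :: real \<Rightarrow> _. (\<forall>\<epsilon>>0. ?adm (D \<epsilon>) \<and> \<not> ?P (D \<epsilon>)) \<and>
        ((\<lambda>\<epsilon>. tv_dist (D \<epsilon>) D\<^sub>0) \<longlongrightarrow> 0) (at_right 0)"
    \<comment> \<open>Unmixing needs a potential for \<open>D\<^sub>0\<close>. If there is none, the
      constant family already works.\<close>
    proof (cases "?P D\<^sub>0")
      case False
      have "tv_dist D\<^sub>0 D\<^sub>0 = 0"
        unfolding tv_dist_def using sets.top by (auto intro: cSUP_const)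
      then show ?thesis
        using D\<^sub>0 False by (intro exI[of _ "\<lambda>_. D\<^sub>0"]) simp
    next
      case True
      \<comment> \<open>The weight is capped at 1 because the family must be admissible for every
        positive \<open>\<epsilon>\<close>, including those above 1.\<close>
      define D where "D = (\<lambda>\<epsilon>. add_point_mass (min \<epsilon> 1) (x, x) D\<^sub>0)"
      have prob: "prob_space D\<^sub>0" and "sets D\<^sub>0 = sets borel"
        using D\<^sub>0 unfolding data_distribution_def by auto
      then have p: "(x, x) \<in> space D\<^sub>0"
        using sets_eq_imp_space_eq[of D\<^sub>0 borel] by simp
      have D: "?adm (D \<epsilon>) \<and> \<not> ?P (D \<epsilon>)" if "\<epsilon> > 0" for \<epsilon>
        using that mix[OF _ _ D\<^sub>0 True] data_distribution_add_point_mass[OF _ _ D\<^sub>0]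
        unfolding D_def by simp
      have lim: "((\<lambda>\<epsilon>. tv_dist (D \<epsilon>) D\<^sub>0) \<longlongrightarrow> 0) (at_right 0)"
      proof (rule tendsto_sandwich)
        show "\<forall>\<^sub>F \<epsilon> in at_right 0. 0 \<le> tv_dist (D \<epsilon>) D\<^sub>0"
          using tv_dist_add_point_mass_nonneg[OF _ _ p prob] eventually_at_right_less[of 0]
          unfolding D_def by (auto elim!: eventually_mono)
        show "\<forall>\<^sub>F \<epsilon> in at_right 0. tv_dist (D \<epsilon>) D\<^sub>0 \<le> min \<epsilon> 1"
          using eventually_at_right_less[of 0] unfolding D_def
          by (rule eventually_mono) (intro tv_dist_add_point_mass_le[OF _ _ p prob], auto)
        have "((\<lambda>\<epsilon>::real. min \<epsilon> 1) \<longlongrightarrow> min 0 1) (at_right 0)"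
          by (intro tendsto_intros)
        then show "((\<lambda>\<epsilon>::real. min \<epsilon> 1) \<longlongrightarrow> 0) (at_right 0)"
          by simp
      qed simp
      show ?thesis
        using D lim by (intro exI[of _ D] conjI allI impI) auto
    qed
  qed
qed

end
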